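(* Let $(S,d_S)$ be a Polish space and let $\mathcal{L}^o$ be the space of loops on $S$. Then $D^o$ is a well-defined distance (a metric) on $\mathcal{L}^o$.
   Context: $(S,d_S)$ is a Polish space (a complete separable metric space). For $a>0$, $D_S([0,a])$ is the set of paths $[0,a]\to S$ that are right-continuous with left limits and, in addition, left-continuous at time $a$. Based loop: an element $l\in D_S([0,t])$ for some $t>0$ with $l(0)=l(t)$; $|l|:=t$ is its duration. For a based loop $l$ of duration $t$ and $r\in[0,t)$, the circular translation $\Theta_r l:[0,t]\to S$ is $\Theta_r l(u)=l(u+r)$ for $u\in[0,t-r]$ and $\Theta_r l(u)=l(u+r-t)$ for $u\in[t-r,t]$. Loop: two based loops $l,l'$ are equivalent iff $|l|=|l'|$ and $l'=\Theta_r l$ for some $r\in[0,|l|)$. A loop is an equivalence class of based loops; $l^o$ denotes the class of $l$, and $\mathcal{L}^o$ the set of loops. For a based loop $l$ let $l^{\mathrm{normalized}}(u)=l(|l|u)$, $u\in[0,1]$. For $l_1,l_2\in D_S([0,1])$, $$d(l_1,l_2)=\inf_\lambda\Big(\sup_{0\le s<t\le1}\Big|\log\tfrac{\lambda(t)-\lambda(s)}{t-s}\Big|+\sup_{u\in[0,1]}d_S(l_1(\lambda(u)),l_2(u))\Big),$$ the infimum being over all increasing bijections $\lambda:[0,1]\to[0,1]$. For based loops, $D(l_1,l_2)=\big||l_1|-|l_2|\big|+d(l_1^{\mathrm{normalized}},l_2^{\mathrm{normalized}})$. For loops, $$D^o(l_1^o,l_2^o)=\inf\{D(l,l'):l\in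 l_1^o,\ l'\in l_2^o\}.$$ *)

theory Defs
  imports "HOL-Analysis.Analysis"
begin

(* A path [0,a] -> S is a function that is undefined outside {0..a}, so that equality of
   functions is equality of paths. For a > 0 and u in the stated ranges, the filters
   at_right u and at_left u only look at points of {0..a}. *)
definition cadlag_paths :: "real \<Rightarrow> (real \<Rightarrow> 'a::topological_space) set" where
  "cadlag_paths a = {f \<in> extensional {0..a}.
     (\<forall>u\<in>{0..<a}. (f \<longlongrightarrow> f u) (at_right u)) \<and>
     (\<forall>u\<in>{0<..a}. \<exists>x. (f \<longlongrightarrow> x) (at_left u)) \<and>
     (f \<longlongrightarrow> f a) (at_left a)}"

(* A based loop is a pair of its duration and its path. *)
type_synonym 'a based_loop = "real \<times> (real \<Rightarrow> 'a)"

abbreviation duration :: "'a based_loop \<Rightarrow> real" where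
  "duration l \<equiv> fst l"

abbreviation path_of :: "'a based_loop \<Rightarrow> real \<Rightarrow> 'a" where
  "path_of l \<equiv> snd l"

definition based_loops :: "'a::topological_space based_loop set" where
  "based_loops = {l. duration l > 0 \<and> path_of l \<in> cadlag_paths (duration l) \<and>
     path_of l 0 = path_of l (duration l)}"

definition circ_translate :: "real \<Rightarrow> 'a based_loop \<Rightarrow> 'a based_loop" where
  "circ_translate r l = (duration l,
     \<lambda>u\<in>{0..duration l}.
       if u \<le> duration l - r then path_of l (u + r) else path_of l (u + r - duration l))"

(* The translate of a based loop by a jump time r is not left-continuous at its final time, so
   it is not a based loop; the relation therefore requires both members to be based loops. *)
definition loop_equiv :: "('a::topological_space based_loop \<times> 'a based_loop) set" where
  "loop_equiv = {(l, l'). l \<in> based_loops \<and> l' \<in> based_loops \<and> duration l = duration l' \<and>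
     (\<exists>r\<in>{0..<duration l}. l' = circ_translate r l)}"

definition loop_space :: "'a::topological_space based_loop set set" where
  "loop_space = based_loops // loop_equiv"

definition normalized :: "'a based_loop \<Rightarrow> real \<Rightarrow> 'a" where
  "normalized l = (\<lambda>u\<in>{0..1}. path_of l (duration l * u))"

definition time_changes :: "(real \<Rightarrow> real) set" where
  "time_changes = {\<phi>. strict_mono_on {0..1} \<phi> \<and> bij_betw \<phi> {0..1} {0..1}}"

(* The suprema may be infinite (the logarithmic slopes of a time change can be unbounded), so
   all distances take values in ennreal. *)
definition skorokhod_dist :: "(real \<Rightarrow> 'a::metric_space) \<Rightarrow> (real \<Rightarrow> 'a) \<Rightarrow> ennreal" where
  "skorokhod_dist f g = (INF \<phi>\<in>time_changes.
     (SUP (s, t)\<in>{(s, t). 0 \<le> s \<and> s < t \<and> t \<le> 1}. ennreal \<bar>ln ((\<phi> t - \<phi> s) / (t - s))\<bar>) +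
     (SUP u\<in>{0..1}. ennreal (dist (f (\<phi> u)) (g u))))"

definition based_loop_dist :: "'a::metric_space based_loop \<Rightarrow> 'a based_loop \<Rightarrow> ennreal" where
  "based_loop_dist l l' =
     ennreal \<bar>duration l - duration l'\<bar> + skorokhod_dist (normalized l) (normalized l')"

definition loop_dist :: "'a::metric_space based_loop set \<Rightarrow> 'a based_loop set \<Rightarrow> ennreal" where
  "loop_dist c c' = (INF l\<in>c. INF l'\<in>c'. based_loop_dist l l')"

lemma circ_translate_0:
  assumes "l \<in> based_loops"
  shows "circ_translate 0 l = l"
proof (rule prod_eqI)
  have "path_of l \<in> extensional {0..duration l}"
    using assms by (simp add: based_loops_def cadlag_paths_def)
  then show "path_of (circ_translate 0 l) = path_of l"
    by (intro ext) (auto simp: circ_translate_def restrict_def extensional_def)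
qed (simp add: circ_translate_def)

lemma circ_translate_circ_translate:
  assumes "l \<in> based_loops" "0 \<le> r" "r < duration l" "0 \<le> s" "s < duration l"
  shows "circ_translate s (circ_translate r l) =
    circ_translate (if r + s < duration l then r + s else r + s - duration l) l"
proof -
  obtain t f where l: "l = (t, f)"
    by (cases l)
  have f: "f 0 = f t"
    using assms(1) by (simp add: l based_loops_def)
  define q where "q = (if r + s < t then r + s else r + s - t)"
  have "path_of (circ_translate s (circ_translate r l)) u =
    path_of (circ_translate q l) u" for u
  proof (cases "u \<in> {0..t}")
    case True
    have path: "path_of (circ_translate p (t, g)) v = (if v \<le> t - p then g (v + p) else g (v + p - t))"
      if "v \<in> {0..t}" for p v and g :: "real \<Rightarrow> 'a"
      using that by (simp add: circ_translate_def)
    define v where "v = (if u \<le> t - s then u + s else u + s - t)"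
    define y where "y = (if u \<le> t - q then u + q else u + q - t)"
    have v: "v \<in> {0..t}"
      using True assms(2-) by (auto simp: v_def l)
    have "circ_translate r l = (t, path_of (circ_translate r l))"
      by (simp add: circ_translate_def l)
    then have "path_of (circ_translate s (circ_translate r l)) u = path_of (circ_translate r l) v"
      using path[OF True, of s "path_of (circ_translate r l)"] by (simp add: v_def)
    also have "\<dots> = f (if v \<le> t - r then v + r else v + r - t)"
      using path[OF v, of r f] by (simp add: l)
    also have "\<dots> = f y"
    proof -
      have "x = y \<or> x = 0 \<and> y = t \<or> x = t \<and> y = 0"
        if "x = (if v \<le> t - r then v + r else v + r - t)" for x
        using that assms(2-) True unfolding y_def q_def v_def l fst_conv atLeastAtMost_iff
        by argo
      with f show ?thesis
        by (metis (full_types))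
    qed
    also have "f y = path_of (circ_translate q l) u"
      using path[OF True, of q f] by (simp add: l y_def)
    finally show ?thesis .
  next
    case False
    then show ?thesis
      unfolding circ_translate_def restrict_def l fst_conv snd_conv by (simp only: if_False)
  qed
  then show ?thesis
    by (intro prod_eqI ext) (simp_all add: l q_def circ_translate_def)
qed

lemma loop_equivI:
  assumes "l \<in> based_loops" "l' \<in> based_loops" "duration l = duration l'"
    and "0 \<le> r" "r < duration l" "l' = circ_translate r l"
  shows "(l, l') \<in> loop_equiv"
  unfolding loop_equiv_def mem_Collect_eq case_prod_conv
  by (intro conjI assms(1-3) bexI[of _ r] assms(6)) (simp add: assms(4,5))

lemma loop_equivE:
  assumes "(l, l') \<in> loop_equiv"
  obtains r where "l \<in> based_loops" "l' \<in> based_loops" "duration l = duration l'"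
    "0 \<le> r" "r < duration l" "l' = circ_translate r l"
  using assms unfolding loop_equiv_def mem_Collect_eq case_prod_conv atLeastLessThan_iff Bex_def
  by blast

lemma equiv_loop_equiv: "equiv (based_loops :: 'a::topological_space based_loop set) loop_equiv"
  (is "equiv ?A ?R")
proof (rule equivI)
  show "?R \<subseteq> ?A \<times> ?A"
    by (auto elim: loop_equivE)
  show "refl_on ?A ?R"
  proof (rule refl_onI)
    fix l :: "'a based_loop"
    assume l: "l \<in> based_loops"
    then have "0 < duration l"
      by (simp add: based_loops_def)
    then show "(l, l) \<in> loop_equiv"
      by (intro loop_equivI[OF l l refl order_refl]) (simp_all only: circ_translate_0[OF l])
  qed
  show "sym ?R"
  proof (rule symI)
    fix l l' :: "'a based_loop"
    assume "(l, l') \<in> loop_equiv"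
    then show "(l', l) \<in> loop_equiv"
    proof (rule loop_equivE)
      fix r
      assume l: "l \<in> based_loops" and l': "l' \<in> based_loops"
        and dur: "duration l = duration l'"
        and r: "0 \<le> r" "r < duration l" and eq: "l' = circ_translate r l"
      show ?thesis
      proof (cases "r = 0")
        case True
        then have "l' = l"
          using eq circ_translate_0[OF l] by simp
        then show ?thesis
          using \<open>(l, l') \<in> loop_equiv\<close> by simp
      next
        case False
        have s: "0 \<le> duration l - r" "duration l - r < duration l"
          using r False by simp_all
        have "circ_translate (duration l - r) l' = l"
          using circ_translate_circ_translate[OF l r s] circ_translate_0[OF l] by (simp add: eq)
        then show ?thesis
          using s dur by (intro loop_equivI[OF l' l, of "duration l - r"]) simp_all
      qed
    qed
  qed
  show "trans ?R"
  proof (rule transI)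
    fix l l' l'' :: "'a based_loop"
    assume 1: "(l, l') \<in> loop_equiv" and 2: "(l', l'') \<in> loop_equiv"
    from 1 show "(l, l'') \<in> loop_equiv"
    proof (rule loop_equivE)
      fix r
      assume l: "l \<in> based_loops" and dur: "duration l = duration l'"
        and r: "0 \<le> r" "r < duration l" and eq: "l' = circ_translate r l"
      from 2 show ?thesis
      proof (rule loop_equivE)
        fix s
        assume l'': "l'' \<in> based_loops" and dur': "duration l' = duration l''"
          and s: "0 \<le> s" "s < duration l'" and eq': "l'' = circ_translate s l'"
        define q where "q = (if r + s < duration l then r + s else r + s - duration l)"
        have "0 \<le> q" "q < duration l"
          using r s dur by (simp_all add: q_def)
        moreover have "l'' = circ_translate q l"
          unfolding q_def eq' eq
          by (rule circ_translate_circ_translate[OF l r s(1)]) (use s dur in simp)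
        ultimately show ?thesis
          using dur dur' by (intro loop_equivI[OF l l'', of q]) simp_all
      qed
    qed
  qed
qed

end

theory Submission imports Defs begin

text \<open>A based loop unrolls to a 1-periodic path on the real line, and its loop consists of the
  translates of that path by its continuity points. A time change lifts to an increasing map
  \<open>\<Lambda>\<close> with \<open>\<Lambda> (x + 1) = \<Lambda> x + 1\<close>, and conjugating \<open>\<Lambda>\<close> by translations keeps its slope bounds. As a
  cadlag path has only countably many jumps, a base point that suits both loops always exists, so
  the distance of two loops is the infimum over all lifts, without any reference to base points.
  Lifts compose, which gives the triangle inequality. At distance zero, a sequence of lifts with
  slopes tending to 1 subconverges to a translation.\<close>

text \<open>The obstacle is the triangle inequality. The infima for the two summands may pick
  different representatives of the middle loop. Rotating one onto the other moves the base point of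
  an outer loop along, possibly onto a jump, where the rotated path fails left-continuity at its
  final time and is no based loop. Based loops therefore cannot simply be matched. On the line every
  translation is allowed, and the choice of base points becomes the freedom in the value of a lift
  at 0. Infima of possibly infinite sums are avoided by working with strict bounds
  \<open>< K\<close> and two real numbers: \<open>a\<close> bounds the absolute logarithms of the
  slopes, \<open>b\<close> the distance of the paths. Both add under composition of lifts.\<close>

section \<open>Cadlag functions on the line and the countability of their jumps\<close>

definition cadlag :: "(real \<Rightarrow> 'a::topological_space) \<Rightarrow> bool" where
  "cadlag h \<longleftrightarrow> (\<forall>x. (h \<longlongrightarrow> h x) (at_right x) \<and> (\<exists>y. (h \<longlongrightarrow> y) (at_left x)))"

text \<open>Each point of \<open>A\<close> starts an open interval free of \<open>A\<close>. These
  intervals are nonempty and pairwise disjoint, and the separable real line has room for only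
  countably many.\<close>

lemma countable_if_right_isolated:
  fixes A :: "real set"
  assumes "\<And>x. x \<in> A \<Longrightarrow> eventually (\<lambda>y. y \<notin> A) (at_right x)"
  shows "countable A"
proof -
  have "\<exists>b>x. \<forall>y>x. y < b \<longrightarrow> y \<notin> A" if "x \<in> A" for x
    using assms[OF that] by (simp add: eventually_at_right_field)
  then obtain b where b_gt: "\<forall>x\<in>A. b x > x \<and> (\<forall>y>x. y < b x \<longrightarrow> y \<notin> A)"
    using bchoice[of A "\<lambda>x b. b > x \<and> (\<forall>y>x. y < b \<longrightarrow> y \<notin> A)"] by blast
  define I where "I x = {x<..<b x}" for x
  have disj: "I x \<inter> I y = {}" if "x \<in> A" "y \<in> A" "x < y" for x y
  proof -
    have "b x \<le> y"
      using b_gt that by force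
    then show ?thesis
      by (auto simp: I_def)
  qed
  have ne: "I x \<noteq> {}" if "x \<in> A" for x
    using bspec[OF b_gt that] by (simp add: I_def)
  have "inj_on I A"
  proof (rule linorder_inj_onI)
    fix x y
    assume "x < y" "x \<in> A" "y \<in> A"
    then show "I x \<noteq> I y"
      using disj[of x y] ne[of x] by auto
  qed (rule linear)
  moreover have "countable (I ` A)"
  proof (rule countable_disjoint_open_subsets)
    show "disjoint (I ` A)"
    proof (rule pairwiseI)
      fix X Y
      assume "X \<in> I ` A" "Y \<in> I ` A" "X \<noteq> Y"
      then obtain x y where xy: "x \<in> A" "y \<in> A" "X = I x" "Y = I y" "x \<noteq> y"
        by blast
      then show "disjnt X Y"
        using disj[of x y] disj[of y x] by (cases x y rule: linorder_cases) (auto simp: disjnt_def)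
    qed
  qed (auto simp: I_def)
  ultimately show ?thesis
    by (rule countable_image_inj_on[rotated])
qed

text \<open>By right-continuity a discontinuity is a point whose left limit differs from the value.
  Jumps above a fixed size are right-isolated: just to the right of \<open>x\<close> all values are
  close to \<open>h x\<close>, hence close to each other.\<close>

lemma countable_discontinuities:
  fixes h :: "real \<Rightarrow> 'a::metric_space"
  assumes "cadlag h"
  shows "countable {x. \<not> isCont h x}"
proof -
  define A where "A n = {x. \<exists>y. (h \<longlongrightarrow> y) (at_left x) \<and> dist y (h x) > 1 / real (Suc n)}" for n
  have "{x. \<not> isCont h x} \<subseteq> (\<Union>n. A n)"
  proof
    fix x
    assume "x \<in> {x. \<not> isCont h x}"
    then have nc: "\<not> (h \<longlongrightarrow> h x) (at x)"
      by (simp add: isCont_def)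
    obtain y where y: "(h \<longlongrightarrow> y) (at_left x)"
      using assms by (auto simp: cadlag_def)
    have "y \<noteq> h x"
      using nc y assms filterlim_split_at[of h "nhds (h x)" x] by (auto simp: cadlag_def)
    then have "0 < dist y (h x)"
      by simp
    then obtain n where "1 / real (Suc n) < dist y (h x)"
      using reals_Archimedean[of "dist y (h x)"] by (auto simp: inverse_eq_divide)
    then show "x \<in> (\<Union>n. A n)"
      using y by (auto simp: A_def)
  qed
  moreover have "countable (A n)" for n
  proof (rule countable_if_right_isolated)
    fix x
    define e where "e = 1 / real (Suc n)"
    have "e > 0"
      by (simp add: e_def)
    have "(h \<longlongrightarrow> h x) (at_right x)"
      using assms by (simp add: cadlag_def)
    then have "eventually (\<lambda>y. dist (h y) (h x) < e / 2) (at_right x)"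
      by (rule tendstoD) (use \<open>e > 0\<close> in simp)
    then obtain b where "b > x" and b: "\<And>y. x < y \<Longrightarrow> y < b \<Longrightarrow> dist (h y) (h x) < e / 2"
      by (auto simp: eventually_at_right_field)
    have "y \<notin> A n" if "x < y" "y < b" for y
    proof
      assume "y \<in> A n"
      then obtain z where z: "(h \<longlongrightarrow> z) (at_left y)" "dist z (h y) > e"
        by (auto simp: A_def e_def)
      have "eventually (\<lambda>w. dist (h w) (h y) \<le> e) (at_left y)"
        unfolding eventually_at_left_field
      proof (intro exI[of _ x] conjI allI impI)
        fix w
        assume "x < w" "w < y"
        then show "dist (h w) (h y) \<le> e"
          using b[of w] b[of y] that dist_triangle2[of "h w" "h y" "h x"] by simp
      qed (use that in simp)
      then have "dist z (h y) \<le> e"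
        by (intro tendsto_upperbound[OF tendsto_dist[OF z(1) tendsto_const]])
           (auto simp: trivial_limit_at_left_real)
      with z show False
        by simp
    qed
    then show "eventually (\<lambda>y. y \<notin> A n) (at_right x)"
      using \<open>b > x\<close> by (auto simp: eventually_at_right_field)
  qed
  ultimately show ?thesis
    by (meson countable_UN countable_subset countableI_type)
qed

lemma filterlim_affine_at_right:
  fixes c d x :: real
  assumes "c > 0"
  shows "filterlim (\<lambda>y. c * y + d) (at_right (c * x + d)) (at_right x)"
  unfolding filterlim_at using assms
  by (auto intro!: tendsto_intros simp: eventually_at_filter)

lemma filterlim_affine_at_left:
  fixes c d x :: real
  assumes "c > 0"
  shows "filterlim (\<lambda>y. c * y + d) (at_left (c * x + d)) (at_left x)"
  unfolding filterlim_at using assms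
  by (auto intro!: tendsto_intros simp: eventually_at_filter)

lemma cadlag_affine:
  fixes c d :: real
  assumes "cadlag h" "c > 0"
  shows "cadlag (\<lambda>x. h (c * x + d))"
  unfolding cadlag_def
proof (intro allI conjI)
  fix x
  show "((\<lambda>x. h (c * x + d)) \<longlongrightarrow> h (c * x + d)) (at_right x)"
    by (rule filterlim_compose[OF _ filterlim_affine_at_right[OF assms(2)]])
       (use assms(1) in \<open>simp add: cadlag_def\<close>)
  obtain y where "(h \<longlongrightarrow> y) (at_left (c * x + d))"
    using assms(1) by (auto simp: cadlag_def)
  from filterlim_compose[OF this filterlim_affine_at_left[OF assms(2)]]
  show "\<exists>y. ((\<lambda>x. h (c * x + d)) \<longlongrightarrow> y) (at_left x)"
    by blast
qed

section \<open>Paths of period 1 and their correspondence with based loops\<close>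

text \<open>Periodicity is phrased with \<open>frac\<close> because \<open>unroll\<close> reads a
  path only at fractional parts; invariance under all integer shifts is
  \<open>circle_path_cong\<close>.\<close>

definition circle_path :: "(real \<Rightarrow> 'a::topological_space) \<Rightarrow> bool" where
  "circle_path h \<longleftrightarrow> (\<forall>x. h (frac x) = h x) \<and> cadlag h"

text \<open>One-sided limits bound \<open>h\<close> near every point even where it jumps;
  compactness of one period makes the bound global. This is the source of the finiteness of the loop
  distance.\<close>

lemma bounded_circle_path:
  fixes h :: "real \<Rightarrow> 'a::metric_space"
  assumes "circle_path h"
  shows "bounded (range h)"
proof -
  have "\<exists>U. open U \<and> x \<in> U \<and> bounded (h ` U)" for x
  proof -
    obtain y where y: "(h \<longlongrightarrow> y) (at_left x)" and r: "(h \<longlongrightarrow> h x) (at_right x)"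
      using assms by (auto simp: circle_path_def cadlag_def)
    obtain a where a: "a < x" "\<And>w. a < w \<Longrightarrow> w < x \<Longrightarrow> dist (h w) y < 1"
      using tendstoD[OF y, of 1] by (auto simp: eventually_at_left_field)
    obtain b where b: "b > x" "\<And>w. x < w \<Longrightarrow> w < b \<Longrightarrow> dist (h w) (h x) < 1"
      using tendstoD[OF r, of 1] by (auto simp: eventually_at_right_field)
    \<comment> \<open>The ball around the left limit catches the points left of \<open>x\<close>,
      the ball around \<open>h x\<close> those from \<open>x\<close> on.\<close>
    have "h ` {a<..<b} \<subseteq> ball y 1 \<union> ball (h x) 1"
    proof
      fix z
      assume "z \<in> h ` {a<..<b}"
      then obtain w where w: "z = h w" "a < w" "w < b"
        by auto
      show "z \<in> ball y 1 \<union> ball (h x) 1"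
        using w a(2)[of w] b(2)[of w] by (cases w x rule: linorder_cases) (auto simp: dist_commute)
    qed
    then have "bounded (h ` {a<..<b})"
      by (meson bounded_Un bounded_ball bounded_subset)
    then show ?thesis
      using a(1) b(1) by (intro exI[of _ "{a<..<b}"]) auto
  qed
  then obtain U where U: "\<And>x. open (U x)" "\<And>x. x \<in> U x" "\<And>x. bounded (h ` U x)"
    by metis
  obtain C where C: "finite C" "{0..1} \<subseteq> (\<Union>x\<in>C. U x)"
    using compactE_image[of "{0..1::real}" UNIV U] U(1,2) by (metis UNIV_I UN_I compact_Icc subsetI)
  have "range h \<subseteq> h ` (\<Union>x\<in>C. U x)"
  proof
    fix z
    assume "z \<in> range h"
    then obtain x where "z = h x"
      by blast
    then have "z = h (frac x)"
      using assms by (simp add: circle_path_def)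
    moreover have "frac x \<in> {0..1}"
      using frac_lt_1[of x] frac_ge_0[of x] by simp
    ultimately show "z \<in> h ` (\<Union>x\<in>C. U x)"
      using C(2) by blast
  qed
  moreover have "bounded (h ` (\<Union>x\<in>C. U x))"
    unfolding image_UN using C(1) U(3) by (intro bounded_UN) auto
  ultimately show ?thesis
    by (rule bounded_subset[rotated])
qed

lemma circle_path_cong:
  assumes "circle_path h" "x - y \<in> \<int>"
  shows "h x = h y"
proof -
  obtain n where "x - y = of_int n"
    using assms(2) by (rule Ints_cases)
  then have "x = y + of_int n"
    by simp
  then have "frac x = frac y"
    by (simp add: frac_def)
  then show ?thesis
    using assms(1) unfolding circle_path_def by metis
qed

lemma circle_path_translate:
  assumes "circle_path h"
  shows "circle_path (\<lambda>x. h (x + r))"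
proof -
  have "h (frac x + r) = h (x + r)" for x
    by (rule circle_path_cong[OF assms]) (simp add: frac_def)
  moreover have "cadlag (\<lambda>x. h (x + r))"
    using cadlag_affine[of h 1 r] assms by (simp add: circle_path_def)
  ultimately show ?thesis
    by (simp add: circle_path_def)
qed

text \<open>This is the periodic extension of \<open>normalized l\<close>. As
  \<open>frac 1 = 0\<close>, the value at the final time is never read; for a based loop it is the
  value at 0.\<close>

definition unroll :: "'a based_loop \<Rightarrow> real \<Rightarrow> 'a" where
  "unroll l x = path_of l (duration l * frac x)"

text \<open>The inverse of \<open>unroll\<close>. The duration is a separate argument because
  unrolling rescales it to 1.\<close>

definition roll :: "real \<Rightarrow> (real \<Rightarrow> 'a) \<Rightarrow> 'a based_loop" where
  "roll t h = (t, \<lambda>u\<in>{0..t}. h (u / t))"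

lemma circle_path_unroll:
  fixes l :: "'a::topological_space based_loop"
  assumes "l \<in> based_loops"
  shows "circle_path (unroll l)"
proof -
  obtain t f where l: "l = (t, f)"
    by (cases l)
  have t: "t > 0" and f0: "f 0 = f t"
    and right: "\<And>u. 0 \<le> u \<Longrightarrow> u < t \<Longrightarrow> (f \<longlongrightarrow> f u) (at_right u)"
    and left: "\<And>u. 0 < u \<Longrightarrow> u \<le> t \<Longrightarrow> \<exists>y. (f \<longlongrightarrow> y) (at_left u)"
    using assms by (auto simp: l based_loops_def cadlag_paths_def)
  have "cadlag (\<lambda>x. f (t * frac x))"
    unfolding cadlag_def
  proof (intro allI conjI)
    fix x :: real
    let ?n = "real_of_int \<lfloor>x\<rfloor>"
    have x: "0 \<le> x - ?n" "x - ?n < 1"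
      by linarith+
    have eq: "t * x + - t * ?n = t * frac x"
      by (simp add: frac_def algebra_simps)
    have "eventually (\<lambda>y. f (t * y + - t * ?n) = f (t * frac y)) (at_right x)"
      unfolding eventually_at_right_field
    proof (intro exI[of _ "?n + 1"] conjI allI impI)
      show "x < ?n + 1"
        by linarith
      fix y
      assume "x < y" "y < ?n + 1"
      then have "\<lfloor>y\<rfloor> = \<lfloor>x\<rfloor>"
        by linarith
      then show "f (t * y + - t * ?n) = f (t * frac y)"
        by (simp add: frac_def algebra_simps)
    qed
    moreover have "((\<lambda>y. f (t * y + - t * ?n)) \<longlongrightarrow> f (t * frac x)) (at_right x)"
      by (rule filterlim_compose[OF _ filterlim_affine_at_right[OF t]], unfold eq)
         (use x t in \<open>auto intro!: right simp: frac_def\<close>)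
    ultimately show "((\<lambda>x. f (t * frac x)) \<longlongrightarrow> f (t * frac x)) (at_right x)"
      by (rule Lim_transform_eventually[rotated])
    \<comment> \<open>Points just left of an integer lie in the preceding period, which
      \<open>\<lceil>x\<rceil> - 1\<close> selects; at other points it equals the floor.\<close>
    let ?m = "real_of_int (\<lceil>x\<rceil> - 1)"
    have "eventually (\<lambda>y. f (t * y + - t * ?m) = f (t * frac y)) (at_left x)"
      unfolding eventually_at_left_field
    proof (intro exI[of _ "?m"] conjI allI impI)
      show "?m < x"
        by linarith
      fix y
      assume "?m < y" "y < x"
      then have "\<lfloor>y\<rfloor> = \<lceil>x\<rceil> - 1"
        by linarith
      then have "?m = of_int \<lfloor>y\<rfloor>"
        by simp
      then show "f (t * y + - t * ?m) = f (t * frac y)"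
        by (simp only: frac_def) (simp add: algebra_simps)
    qed
    have "\<exists>z. (f \<longlongrightarrow> z) (at_left (t * x + - t * ?m))"
    proof -
      have m: "0 < x - ?m" "x - ?m \<le> 1"
        by linarith+
      have "t * x + - t * ?m = t * (x - ?m)"
        by (simp add: algebra_simps)
      then show ?thesis
        using left[of "t * (x - ?m)"] m t by simp
    qed
    then obtain z where "(f \<longlongrightarrow> z) (at_left (t * x + - t * ?m))" ..
    from filterlim_compose[OF this filterlim_affine_at_left[OF t]]
    have "((\<lambda>x. f (t * frac x)) \<longlongrightarrow> z) (at_left x)"
      by (rule Lim_transform_eventually) fact
    then show "\<exists>z. ((\<lambda>x. f (t * frac x)) \<longlongrightarrow> z) (at_left x)" ..
  qed
  moreover have "unroll l = (\<lambda>x. f (t * frac x))"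
    by (rule ext) (simp add: unroll_def l)
  moreover have "frac (frac x) = frac x" for x :: real
    by (simp add: frac_eq frac_lt_1)
  ultimately show ?thesis
    by (simp add: circle_path_def)
qed

text \<open>Only \<open>u = 1\<close> is delicate: there \<open>unroll\<close> reads the initial
  value and \<open>normalized\<close> the final one, which agree because the loop closes up.\<close>

lemma unroll_eq_normalized:
  assumes "l \<in> based_loops" "u \<in> {0..1}"
  shows "normalized l u = unroll l u"
proof (cases "u = 1")
  case True
  then show ?thesis
    using assms by (simp add: normalized_def unroll_def based_loops_def)
next
  case False
  then have "frac u = u"
    using assms(2) by (simp add: frac_eq)
  then show ?thesis
    using assms(2) by (simp add: normalized_def unroll_def)
qed

lemma unroll_roll:
  fixes h :: "real \<Rightarrow> 'a::topological_space"
  assumes "t > 0" "circle_path h"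
  shows "unroll (roll t h) = h"
proof
  fix x :: real
  have "frac x \<ge> 0" "frac x \<le> 1"
    using frac_lt_1[of x] by simp_all
  then show "unroll (roll t h) x = h x"
    using assms by (simp add: unroll_def roll_def circle_path_def mult_le_cancel_left1)
qed

text \<open>The times 0 and \<open>t\<close> are the same point of the circle, so continuity at 0
  supplies left-continuity at the final time.\<close>

lemma roll_in_based_loops:
  fixes h :: "real \<Rightarrow> 'a::topological_space"
  assumes t: "t > 0" and h: "circle_path h" and cont: "isCont h 0"
  shows "roll t h \<in> based_loops"
proof -
  define g where "g u = h (u / t)" for u
  have "cadlag (\<lambda>u. h ((1 / t) * u + 0))"
    using h t by (intro cadlag_affine) (auto simp: circle_path_def)
  then have g: "cadlag g"
    by (simp add: g_def[abs_def])
  \<comment> \<open>Periodicity carries continuity from 0 to 1, the normalized final time.\<close>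
  have shift: "(\<lambda>x. h (x - 1)) = h"
    by (rule ext, rule circle_path_cong[OF h]) (simp add: frac_def)
  have "isCont (\<lambda>x. h (x - 1)) 1"
    by (rule isCont_o2[of 1 "\<lambda>x. x - 1" h]) (use cont in auto)
  then have "isCont h 1"
    by (simp only: shift)
  then have "isCont (\<lambda>u. h (u / t)) t"
    using t by (intro isCont_o2[of t "\<lambda>u. u / t" h] continuous_intros) auto
  then have "(g \<longlongrightarrow> g t) (at_left t)"
    unfolding g_def isCont_def by (rule filterlim_mono[OF _ order_refl at_le]) simp
  moreover have "g 0 = g t"
    unfolding g_def by (rule circle_path_cong[OF h]) (use t in simp)
  moreover have right: "eventually (\<lambda>y. g y = restrict g {0..t} y) (at_right u)"
    if "0 \<le> u" "u < t" for u
    using that by (auto simp: eventually_at_right_field intro!: exI[of _ t])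
  moreover have left: "eventually (\<lambda>y. g y = restrict g {0..t} y) (at_left u)"
    if "0 < u" "u \<le> t" for u
    using that by (auto simp: eventually_at_left_field intro!: exI[of _ 0])
  have "(restrict g {0..t} \<longlongrightarrow> restrict g {0..t} u) (at_right u)" if "u \<in> {0..<t}" for u
    using that g by (intro Lim_transform_eventually[OF _ right]) (auto simp: cadlag_def)
  moreover have "\<exists>y. (restrict g {0..t} \<longlongrightarrow> y) (at_left u)" if "u \<in> {0<..t}" for u
  proof -
    obtain y where "(g \<longlongrightarrow> y) (at_left u)"
      using g by (auto simp: cadlag_def)
    then have "(restrict g {0..t} \<longlongrightarrow> y) (at_left u)"
      by (rule Lim_transform_eventually) (use left that in simp)
    then show ?thesis ..
  qed
  \<comment> \<open>\<open>calculation(1)\<close> is the left-continuity of \<open>g\<close> at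
    \<open>t\<close>.\<close>
  moreover have "(restrict g {0..t} \<longlongrightarrow> restrict g {0..t} t) (at_left t)"
    using t calculation(1) by (intro Lim_transform_eventually[OF _ left]) auto
  ultimately show ?thesis
    using t by (simp add: based_loops_def cadlag_paths_def roll_def flip: g_def)
qed

text \<open>Equality of the paths as functions also needs the points outside the time interval,
  where both are \<open>undefined\<close>.\<close>

lemma roll_unroll:
  assumes "l \<in> based_loops"
  shows "roll (duration l) (unroll l) = l"
proof -
  have "path_of (roll (duration l) (unroll l)) u = path_of l u" for u
  proof (cases "u \<in> {0..duration l}")
    case True
    then have u: "u / duration l \<in> {0..1}"
      using assms by (auto simp: based_loops_def)
    have "path_of (roll (duration l) (unroll l)) u = normalized l (u / duration l)"
      using True by (simp add: roll_def unroll_eq_normalized[OF assms u])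
    also have "\<dots> = path_of l u"
      using u assms by (auto simp: normalized_def based_loops_def)
    finally show ?thesis .
  next
    case False
    moreover have "path_of l \<in> extensional {0..duration l}"
      using assms by (simp add: based_loops_def cadlag_paths_def)
    ultimately have "path_of l u = undefined"
      by (rule extensional_arb[rotated])
    then show ?thesis
      using False by (simp only: roll_def snd_conv restrict_def if_False)
  qed
  then have "path_of (roll (duration l) (unroll l)) = path_of l"
    by (rule ext)
  then show ?thesis
    by (rule prod_eqI[rotated]) (simp add: roll_def)
qed

text \<open>The two branches of a circular translation differ by a full period, which unrolling does
  not see.\<close>

lemma circ_translate_eq_roll:
  assumes l: "l \<in> based_loops" and r: "0 \<le> r" "r < duration l"
  shows "circ_translate r l = roll (duration l) (\<lambda>x. unroll l (x + r / duration l))"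
proof -
  define t where "t = duration l"
  have t: "t > 0" "r < t" and f0: "path_of l 0 = path_of l t"
    using l r by (simp_all add: based_loops_def t_def)
  have path: "path_of l v = unroll l (v / t)" if "v \<in> {0..t}" for v
    using arg_cong[OF roll_unroll[OF l], of "\<lambda>l. path_of l v"] that
    by (simp add: roll_def t_def)
  have "path_of (circ_translate r l) u = unroll l (u / t + r / t)" if u: "u \<in> {0..t}" for u
  proof (cases "u \<le> t - r")
    case True
    then show ?thesis
      using u r by (simp add: circ_translate_def t_def[symmetric] path add_divide_distrib)
  next
    case False
    then have "path_of (circ_translate r l) u = unroll l ((u + r - t) / t)"
      using u t by (simp add: circ_translate_def t_def[symmetric] path)
    also have "\<dots> = unroll l (u / t + r / t)"
      by (rule circle_path_cong[OF circle_path_unroll[OF l]])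
         (use t in \<open>simp add: add_divide_distrib diff_divide_distrib frac_def\<close>)
    finally show ?thesis .
  qed
  then show ?thesis
    by (intro prod_eqI ext) (simp_all add: circ_translate_def roll_def t_def restrict_def)
qed

text \<open>Any real \<open>r\<close> may be reduced modulo 1, and
  \<open>duration l * frac r\<close> is then an admissible rotation time. That \<open>l'\<close> is
  a based loop keeps the rotation away from jumps.\<close>

lemma loop_equiv_iff_unroll:
  fixes l l' :: "'a::topological_space based_loop"
  assumes l: "l \<in> based_loops" and l': "l' \<in> based_loops"
  shows "(l, l') \<in> loop_equiv \<longleftrightarrow>
    duration l = duration l' \<and> (\<exists>r. \<forall>x. unroll l' x = unroll l (x + r))"
proof
  assume "(l, l') \<in> loop_equiv"
  then obtain r where r: "duration l = duration l'" "0 \<le> r" "r < duration l"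
    "l' = circ_translate r l"
    by (rule loop_equivE)
  then have "unroll l' = (\<lambda>x. unroll l (x + r / duration l))"
    using circ_translate_eq_roll[OF l r(2,3)]
      unroll_roll[OF _ circle_path_translate[OF circle_path_unroll[OF l]]] by simp
  then show "duration l = duration l' \<and> (\<exists>r. \<forall>x. unroll l' x = unroll l (x + r))"
    using r(1) by auto
next
  assume "duration l = duration l' \<and> (\<exists>r. \<forall>x. unroll l' x = unroll l (x + r))"
  then obtain r where d: "duration l = duration l'"
    and r: "\<And>x. unroll l' x = unroll l (x + r)"
    by blast
  have pos: "duration l > 0"
    using l by (simp add: based_loops_def)
  have "unroll l' = (\<lambda>x. unroll l (x + frac r))"
    by (rule ext, unfold r, rule circle_path_cong[OF circle_path_unroll[OF l]])
      (simp add: frac_def)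
  then have "l' = roll (duration l) (\<lambda>x. unroll l (x + duration l * frac r / duration l))"
    using roll_unroll[OF l'] d pos by simp
  also have "\<dots> = circ_translate (duration l * frac r) l"
    using pos frac_lt_1[of r] by (intro circ_translate_eq_roll[OF l, symmetric]) simp_all
  finally show "(l, l') \<in> loop_equiv"
    using pos frac_lt_1[of r] by (intro loop_equivI[OF l l' d]) simp_all
qed

section \<open>Lifts of time changes to the line\<close>

text \<open>These are lifts of degree one circle homeomorphisms whose slopes have absolute logarithm
  at most \<open>a\<close>, multiplied out so that \<open>s = t\<close> needs no exception. No value
  at 0 is prescribed.\<close>

definition circle_changes :: "real \<Rightarrow> (real \<Rightarrow> real) set" where
  "circle_changes a = {\<Lambda>. (\<forall>x. \<Lambda> (x + 1) = \<Lambda> x + 1) \<and>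
     (\<forall>s t. s \<le> t \<longrightarrow> exp (- a) * (t - s) \<le> \<Lambda> t - \<Lambda> s \<and> \<Lambda> t - \<Lambda> s \<le> exp a * (t - s))}"

lemma circle_changesI:
  assumes "\<And>x. \<Lambda> (x + 1) = \<Lambda> x + 1"
    and "\<And>s t. s \<le> t \<Longrightarrow> exp (- a) * (t - s) \<le> \<Lambda> t - \<Lambda> s"
    and "\<And>s t. s \<le> t \<Longrightarrow> \<Lambda> t - \<Lambda> s \<le> exp a * (t - s)"
  shows "\<Lambda> \<in> circle_changes a"
  using assms by (simp add: circle_changes_def)

lemma circle_changesD:
  assumes "\<Lambda> \<in> circle_changes a"
  shows "\<Lambda> (x + 1) = \<Lambda> x + 1"
    and "s \<le> t \<Longrightarrow> exp (- a) * (t - s) \<le> \<Lambda> t - \<Lambda> s"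
    and "s \<le> t \<Longrightarrow> \<Lambda> t - \<Lambda> s \<le> exp a * (t - s)"
  using assms by (simp_all add: circle_changes_def)

lemma id_in_circle_changes: "(\<lambda>x. x) \<in> circle_changes 0"
  by (rule circle_changesI) simp_all

text \<open>The shifts \<open>r\<close> and \<open>c\<close> are independent: they move the base
  points of the two paths being compared.\<close>

lemma circle_changes_translate:
  assumes "\<Lambda> \<in> circle_changes a"
  shows "(\<lambda>x. \<Lambda> (x + r) - c) \<in> circle_changes a"
proof (rule circle_changesI)
  show "\<Lambda> (x + 1 + r) - c = \<Lambda> (x + r) - c + 1" for x
    using circle_changesD(1)[OF assms, of "x + r"] by (simp add: algebra_simps)
  fix s t :: real
  assume "s \<le> t"
  then show "exp (- a) * (t - s) \<le> \<Lambda> (t + r) - c - (\<Lambda> (s + r) - c)"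
    "\<Lambda> (t + r) - c - (\<Lambda> (s + r) - c) \<le> exp a * (t - s)"
    using circle_changesD(2,3)[OF assms, of "s + r" "t + r"] by simp_all
qed

lemma strict_mono_circle_change:
  assumes "\<Lambda> \<in> circle_changes a"
  shows "strict_mono \<Lambda>"
proof (rule strict_monoI)
  fix s t :: real
  assume "s < t"
  then have "0 < exp (- a) * (t - s)"
    by simp
  also have "\<dots> \<le> \<Lambda> t - \<Lambda> s"
    using \<open>s < t\<close> by (intro circle_changesD(2)[OF assms]) simp
  finally show "\<Lambda> s < \<Lambda> t"
    by simp
qed

text \<open>Slopes multiply, so the bounds on their logarithms add.\<close>

lemma circle_change_compose:
  assumes L: "\<Lambda> \<in> circle_changes a" and M: "M \<in> circle_changes b"
  shows "(\<lambda>x. \<Lambda> (M x)) \<in> circle_changes (a + b)"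
proof (rule circle_changesI)
  show "\<Lambda> (M (x + 1)) = \<Lambda> (M x) + 1" for x
    by (simp add: circle_changesD(1)[OF L] circle_changesD(1)[OF M])
  fix s t :: real
  assume st: "s \<le> t"
  then have Mst: "M s \<le> M t"
    using strict_mono_circle_change[OF M] by (simp add: strict_mono_less_eq)
  have "exp (- (a + b)) * (t - s) = exp (- a) * (exp (- b) * (t - s))"
    by (simp flip: exp_add)
  also have "\<dots> \<le> exp (- a) * (M t - M s)"
    by (intro mult_left_mono circle_changesD(2)[OF M] st) simp
  also have "\<dots> \<le> \<Lambda> (M t) - \<Lambda> (M s)"
    by (rule circle_changesD(2)[OF L Mst])
  finally show "exp (- (a + b)) * (t - s) \<le> \<Lambda> (M t) - \<Lambda> (M s)" .
  have "\<Lambda> (M t) - \<Lambda> (M s) \<le> exp a * (M t - M s)"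
    by (rule circle_changesD(3)[OF L Mst])
  also have "\<dots> \<le> exp a * (exp b * (t - s))"
    by (intro mult_left_mono circle_changesD(3)[OF M] st) simp
  also have "\<dots> = exp (a + b) * (t - s)"
    by (simp add: exp_add)
  finally show "\<Lambda> (M t) - \<Lambda> (M s) \<le> exp (a + b) * (t - s)" .
qed

lemma continuous_circle_change:
  assumes "\<Lambda> \<in> circle_changes a"
  shows "continuous_on X \<Lambda>"
proof -
  have "(exp a)-lipschitz_on UNIV \<Lambda>"
  proof (rule lipschitz_onI)
    fix x y :: real
    show "dist (\<Lambda> x) (\<Lambda> y) \<le> exp a * dist x y"
    proof (cases x y rule: le_cases)
      case le
      then have "\<Lambda> x \<le> \<Lambda> y"
        using strict_mono_circle_change[OF assms] by (simp add: strict_mono_less_eq)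
      then show ?thesis
        using circle_changesD(3)[OF assms le] le by (simp add: dist_real_def)
    next
      case ge
      then have "\<Lambda> y \<le> \<Lambda> x"
        using strict_mono_circle_change[OF assms] by (simp add: strict_mono_less_eq)
      then show ?thesis
        using circle_changesD(3)[OF assms ge] ge by (simp add: dist_real_def)
    qed
  qed simp
  then have "continuous_on UNIV \<Lambda>"
    by (rule lipschitz_on_continuous_on)
  then show ?thesis
    by (rule continuous_on_subset) simp
qed

section \<open>Closeness of periodic paths up to a lift\<close>

text \<open>As in \<open>skorokhod_dist\<close>, the first path is the one that is
  reparametrized.\<close>

definition circle_close ::
  "real \<Rightarrow> real \<Rightarrow> (real \<Rightarrow> 'a::metric_space) \<Rightarrow> (real \<Rightarrow> 'a) \<Rightarrow> bool" where
  "circle_close a b f g \<longleftrightarrow> (\<exists>\<Lambda>\<in>circle_changes a. \<forall>x. dist (f (\<Lambda> x)) (g x) \<le> b)"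

text \<open>This makes base points irrelevant: the lift \<open>\<Lambda> (x - s) + r\<close> serves
  the untranslated paths.\<close>

lemma circle_close_translate:
  assumes "circle_close a b (\<lambda>x. f (x + r)) (\<lambda>x. g (x + s))"
  shows "circle_close a b f g"
proof -
  obtain \<Lambda> where L: "\<Lambda> \<in> circle_changes a"
    and d: "\<And>x. dist (f (\<Lambda> x + r)) (g (x + s)) \<le> b"
    using assms by (auto simp: circle_close_def)
  have "dist (f (\<Lambda> (x + - s) - - r)) (g x) \<le> b" for x
    using d[of "x - s"] by simp
  then show ?thesis
    unfolding circle_close_def
    by (intro bexI[OF _ circle_changes_translate[OF L, of "- s" "- r"]] allI)
qed

text \<open>The triangle inequality on the circle: the first estimate is evaluated at
  \<open>M x\<close>, so the same middle value \<open>g (M x)\<close> occurs in both.\<close>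

lemma circle_close_trans:
  assumes "circle_close a b f g" "circle_close a' b' g h"
  shows "circle_close (a + a') (b + b') f h"
proof -
  obtain \<Lambda> where L: "\<Lambda> \<in> circle_changes a" and d: "\<And>x. dist (f (\<Lambda> x)) (g x) \<le> b"
    using assms(1) by (auto simp: circle_close_def)
  obtain M where M: "M \<in> circle_changes a'" and e: "\<And>x. dist (g (M x)) (h x) \<le> b'"
    using assms(2) by (auto simp: circle_close_def)
  have "dist (f (\<Lambda> (M x))) (h x) \<le> b + b'" for x
    using dist_triangle[of "f (\<Lambda> (M x))" "h x" "g (M x)"] d[of "M x"] e[of x] by simp
  then show ?thesis
    unfolding circle_close_def by (intro bexI[OF _ circle_change_compose[OF L M]] allI)
qed

lemma circle_close_exists:
  assumes "circle_path f" "circle_path g"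
  obtains b where "0 \<le> b" "circle_close 0 b f g"
proof -
  have "bounded (range f \<union> range g)"
    using assms by (simp add: bounded_circle_path)
  then obtain b where "\<forall>y\<in>range f \<union> range g. \<forall>z\<in>range f \<union> range g. dist y z \<le> b"
    unfolding bounded_two_points by blast
  then have b: "dist (f x) (g x) \<le> b" for x
    by blast
  show ?thesis
  proof (rule that)
    show "0 \<le> b"
      using zero_le_dist b[of 0] by (rule order_trans)
    show "circle_close 0 b f g"
      unfolding circle_close_def using b by (intro bexI[OF _ id_in_circle_changes] allI)
  qed
qed

text \<open>The starting points of the lifts converge modulo 1 along a subsequence, so the lifts
  converge pointwise to a translation. This gives the claim at the continuity points of f, and
  right-continuity extends it to all points.\<close>

lemma circle_close_imp_translate:
  fixes f g :: "real \<Rightarrow> 'a::metric_space"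
  assumes f: "circle_path f" and g: "circle_path g"
    and close: "\<And>e. e > 0 \<Longrightarrow> \<exists>a b. 0 \<le> a \<and> 0 \<le> b \<and> a + b < e \<and> circle_close a b f g"
  shows "\<exists>r. \<forall>x. g x = f (x + r)"
proof -
  have "\<exists>\<Lambda> a b. 0 \<le> a \<and> 0 \<le> b \<and> a + b < 1 / real (Suc n) \<and> \<Lambda> \<in> circle_changes a \<and>
    (\<forall>x. dist (f (\<Lambda> x)) (g x) \<le> b)" for n
  proof -
    have "0 < 1 / real (Suc n)"
      by simp
    from close[OF this] show ?thesis
      unfolding circle_close_def by blast
  qed
  then obtain \<Lambda> a b where a: "\<And>n. 0 \<le> a n" and b: "\<And>n. 0 \<le> b n"
    and ab: "\<And>n. a n + b n < 1 / real (Suc n)" and L: "\<And>n. \<Lambda> n \<in> circle_changes (a n)"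
    and d: "\<And>n x. dist (f (\<Lambda> n x)) (g x) \<le> b n"
    by metis
  have lim: "(\<lambda>n. 1 / real (Suc n)) \<longlonglongrightarrow> 0"
    using LIMSEQ_inverse_real_of_nat by (simp add: inverse_eq_divide)
  have le: "a n \<le> 1 / real (Suc n)" "b n \<le> 1 / real (Suc n)" for n
    using a[of n] b[of n] ab[of n] by linarith+
  have a_lim: "a \<longlonglongrightarrow> 0" and b_lim: "b \<longlonglongrightarrow> 0"
    by (rule tendsto_sandwich[OF _ _ tendsto_const lim];
        simp only: a b le eventually_True)+
  \<comment> \<open>Integer parts of the starting points are invisible to \<open>f\<close>; dropping
    them gives a sequence in a compact interval.\<close>
  have "\<forall>n. frac (\<Lambda> n 0) \<in> {0..1}"
    by (simp add: frac_lt_1 less_imp_le)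
  then obtain r \<sigma> where \<sigma>: "strict_mono \<sigma>" and "((\<lambda>n. frac (\<Lambda> n 0)) \<circ> \<sigma>) \<longlonglongrightarrow> r"
    using seq_compactE[OF compact_imp_seq_compact[OF compact_Icc[of "0::real" 1]]]
    by metis
  then have r: "(\<lambda>n. frac (\<Lambda> (\<sigma> n) 0)) \<longlonglongrightarrow> r"
    by (simp add: o_def)
  have a_lim': "(\<lambda>n. a (\<sigma> n)) \<longlonglongrightarrow> 0" and b_lim': "(\<lambda>n. b (\<sigma> n)) \<longlonglongrightarrow> 0"
    using LIMSEQ_subseq_LIMSEQ[OF a_lim \<sigma>] LIMSEQ_subseq_LIMSEQ[OF b_lim \<sigma>]
    by (simp_all add: o_def)
  \<comment> \<open>The increment of a lift from 0 to \<open>x\<close> is squeezed between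
    \<open>exp (- a) * x\<close> and \<open>exp a * x\<close>, both tending to \<open>x\<close>.
    Negative arguments are covered at the end by periodicity.\<close>
  have eq_cont: "g x = f (x + r)" if "0 \<le> x" "isCont f (x + r)" for x
  proof -
    have e1: "(\<lambda>n. exp (- a (\<sigma> n)) * (x - 0)) \<longlonglongrightarrow> exp (- 0) * (x - 0)"
      by (intro tendsto_intros a_lim')
    have e2: "(\<lambda>n. exp (a (\<sigma> n)) * (x - 0)) \<longlonglongrightarrow> exp 0 * (x - 0)"
      by (intro tendsto_intros a_lim')
    have "(\<lambda>n. \<Lambda> (\<sigma> n) x - \<Lambda> (\<sigma> n) 0) \<longlonglongrightarrow> x"
      by (rule tendsto_sandwich[OF _ _ e1[simplified] e2[simplified]])
         (use circle_changesD(2,3)[OF L that(1)] in \<open>simp_all add: always_eventually\<close>)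
    from tendsto_add[OF this r]
    have "(\<lambda>n. f (\<Lambda> (\<sigma> n) x - \<Lambda> (\<sigma> n) 0 + frac (\<Lambda> (\<sigma> n) 0))) \<longlonglongrightarrow> f (x + r)"
      by (rule isCont_tendsto_compose[OF that(2)])
    moreover have "f (\<Lambda> (\<sigma> n) x - \<Lambda> (\<sigma> n) 0 + frac (\<Lambda> (\<sigma> n) 0)) = f (\<Lambda> (\<sigma> n) x)" for n
      by (rule circle_path_cong[OF f]) (simp add: frac_def)
    ultimately have "(\<lambda>n. dist (f (\<Lambda> (\<sigma> n) x)) (g x)) \<longlonglongrightarrow> dist (f (x + r)) (g x)"
      by (intro tendsto_intros) simp
    then have "dist (f (x + r)) (g x) \<le> 0"
      by (rule LIMSEQ_le[OF _ b_lim']) (use d in blast)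
    then show ?thesis
      by simp
  qed
  have eq: "g x = f (x + r)" if "0 \<le> x" for x
  proof (rule ccontr)
    assume "g x \<noteq> f (x + r)"
    then have "0 < dist (g x) (f (x + r))"
      by simp
    moreover have "((\<lambda>y. dist (g y) (f (y + r))) \<longlongrightarrow> dist (g x) (f (x + r))) (at_right x)"
      using g circle_path_translate[OF f, of r]
      by (intro tendsto_dist) (auto simp: circle_path_def cadlag_def)
    ultimately have "eventually (\<lambda>y. 0 < dist (g y) (f (y + r))) (at_right x)"
      by (rule order_tendstoD(1)[rotated])
    then obtain z where "x < z" and z: "\<And>y. x < y \<Longrightarrow> y < z \<Longrightarrow> g y \<noteq> f (y + r)"
      unfolding eventually_at_right_field by auto
    \<comment> \<open>A disagreement would persist on a whole interval to the right, which cannot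
      consist of jumps of the translated \<open>f\<close> only.\<close>
    have "countable ((\<lambda>y. y - r) ` {y. \<not> isCont f y})"
      using f by (intro countable_image countable_discontinuities) (simp add: circle_path_def)
    moreover have "uncountable {x<..<z}"
      using \<open>x < z\<close> by (simp add: uncountable_open_interval)
    ultimately have "\<not> {x<..<z} \<subseteq> (\<lambda>y. y - r) ` {y. \<not> isCont f y}"
      using countable_subset by blast
    then obtain y where y: "y \<in> {x<..<z}" "y \<notin> (\<lambda>y. y - r) ` {y. \<not> isCont f y}"
      by blast
    have "isCont f (y + r)"
    proof (rule ccontr)
      assume "\<not> isCont f (y + r)"
      then have "y + r - r \<in> (\<lambda>y. y - r) ` {y. \<not> isCont f y}"
        by blast
      with y(2) show False
        by simp
    qed
    then show False
      using y(1) z[of y] eq_cont[of y] \<open>0 \<le> x\<close> by simp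
  qed
  have "g x = f (x + r)" for x
  proof -
    have "g x = g (frac x)"
      using g by (simp add: circle_path_def)
    also have "\<dots> = f (frac x + r)"
      by (rule eq) simp
    also have "\<dots> = f (x + r)"
      by (rule circle_path_cong[OF f]) (simp add: frac_def)
    finally show ?thesis .
  qed
  then show ?thesis
    by blast
qed

section \<open>Passing between time changes of the unit interval and lifts\<close>

text \<open>The fixed endpoints make consecutive copies of a time change fit together at the
  integers.\<close>

lemma time_change_ends:
  assumes "\<phi> \<in> time_changes"
  shows "\<phi> 0 = 0" "\<phi> 1 = 1"
proof -
  have mono: "\<phi> s \<le> \<phi> t" if "0 \<le> s" "s \<le> t" "t \<le> 1" for s t
    using assms that by (intro strict_mono_on_leD[of "{0..1}" \<phi>]) (auto simp: time_changes_def)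
  have im: "\<phi> ` {0..1} = {0..1}"
    using assms by (simp add: time_changes_def bij_betw_def)
  obtain s where s: "s \<in> {0..1}" "\<phi> s = 0"
    using im by (metis atLeastAtMost_iff imageE order_refl zero_le_one)
  obtain t where t: "t \<in> {0..1}" "\<phi> t = 1"
    using im by (metis atLeastAtMost_iff imageE order_refl zero_le_one)
  have "\<phi> 0 \<in> {0..1}" "\<phi> 1 \<in> {0..1}"
    using im by auto
  then show "\<phi> 0 = 0" "\<phi> 1 = 1"
    using mono[of 0 s] mono[of t 1] s t by auto
qed

lemma abs_ln_le_iff:
  fixes a p :: real
  assumes "p > 0"
  shows "\<bar>ln p\<bar> \<le> a \<longleftrightarrow> exp (- a) \<le> p \<and> p \<le> exp a"
proof -
  have "- a \<le> ln p \<longleftrightarrow> exp (- a) \<le> exp (ln p)" "ln p \<le> a \<longleftrightarrow> exp (ln p) \<le> exp a"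
    by (simp_all only: exp_le_cancel_iff)
  then show ?thesis
    using assms by (auto simp: abs_le_iff)
qed

text \<open>An interval across integers splits into a partial period at each end and full periods
  between. Full periods have slope 1, which respects the bounds because
  \<open>0 \<le> a\<close>.\<close>

lemma time_change_lift:
  assumes \<phi>: "\<phi> \<in> time_changes" and a: "0 \<le> a"
    and slope: "\<And>s t. 0 \<le> s \<Longrightarrow> s < t \<Longrightarrow> t \<le> 1 \<Longrightarrow> \<bar>ln ((\<phi> t - \<phi> s) / (t - s))\<bar> \<le> a"
  obtains \<Lambda> where "\<Lambda> \<in> circle_changes a" "\<And>x. \<Lambda> x = of_int \<lfloor>x\<rfloor> + \<phi> (frac x)"
proof
  let ?L = "\<lambda>x. of_int \<lfloor>x\<rfloor> + \<phi> (frac x)"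
  note ends = time_change_ends[OF \<phi>]
  have bounds: "exp (- a) * (t - s) \<le> \<phi> t - \<phi> s \<and> \<phi> t - \<phi> s \<le> exp a * (t - s)"
    if "0 \<le> s" "s \<le> t" "t \<le> 1" for s t
  proof (cases "s = t")
    case False
    with that have "s < t"
      by simp
    moreover from this have "\<phi> s < \<phi> t"
      using \<phi> that by (auto simp: time_changes_def intro: strict_mono_onD)
    ultimately show ?thesis
      using abs_ln_le_iff[of "(\<phi> t - \<phi> s) / (t - s)" a] slope[of s t] that
      by (simp add: pos_le_divide_eq pos_divide_le_eq)
  qed simp
  show "?L \<in> circle_changes a"
  proof (rule circle_changesI)
    show "?L (x + 1) = ?L x + 1" for x
      by (simp add: frac_def)
    fix s t :: real
    assume st: "s \<le> t"
    have fr: "0 \<le> frac s" "frac s \<le> 1" "0 \<le> frac t" "frac t \<le> 1"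
      using frac_lt_1[of s] frac_lt_1[of t] by simp_all
    have "exp (- a) * (t - s) \<le> ?L t - ?L s \<and> ?L t - ?L s \<le> exp a * (t - s)"
    proof (cases "\<lfloor>s\<rfloor> = \<lfloor>t\<rfloor>")
      case True
      then have "frac t - frac s = t - s"
        by (simp add: frac_def)
      then show ?thesis
        using bounds[of "frac s" "frac t"] fr st True by simp
    next
      case False
      \<comment> \<open>The number of full periods strictly inside; it is 0 when \<open>s\<close>
        and \<open>t\<close> lie in adjacent periods, hence the \<open>- 1\<close>.\<close>
      define N where "N = real_of_int (\<lfloor>t\<rfloor> - \<lfloor>s\<rfloor> - 1)"
      have "0 \<le> \<lfloor>t\<rfloor> - \<lfloor>s\<rfloor> - 1"
        using False floor_mono[OF st] by linarith
      then have "0 \<le> N"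
        by (simp add: N_def)
      moreover have "exp (- a) \<le> 1" "1 \<le> exp a"
        using a by simp_all
      ultimately have N: "exp (- a) * N \<le> N" "N \<le> exp a * N"
        by (auto intro: mult_left_le_one_le simp: mult_le_cancel_right1)
      have eq: "t - s = frac t + N + (1 - frac s)"
        by (simp add: N_def frac_def)
      have "?L t - ?L s = (\<phi> (frac t) - \<phi> 0) + N + (\<phi> 1 - \<phi> (frac s))"
        by (simp add: N_def ends)
      then show ?thesis
        using bounds[of 0 "frac t"] bounds[of "frac s" 1] fr N unfolding eq distrib_left
        by simp
    qed
    then show "exp (- a) * (t - s) \<le> ?L t - ?L s" "?L t - ?L s \<le> exp a * (t - s)"
      by simp_all
  qed
qed simp

text \<open>Fixing 0 forces fixing 1, and the intermediate value theorem gives surjectivity onto the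
  unit interval.\<close>

lemma circle_change_imp_time_change:
  assumes M: "\<phi> \<in> circle_changes a" and start: "\<phi> 0 = 0"
  shows "\<phi> \<in> time_changes"
    and "s < t \<Longrightarrow> \<bar>ln ((\<phi> t - \<phi> s) / (t - s))\<bar> \<le> a"
proof -
  have mono: "strict_mono \<phi>"
    by (rule strict_mono_circle_change[OF M])
  have ends: "\<phi> 0 = 0" "\<phi> 1 = 1"
    using circle_changesD(1)[OF M, of 0] start by simp_all
  have "\<phi> ` {0..1} = {0..1}"
  proof (intro equalityI subsetI)
    fix y
    assume "y \<in> \<phi> ` {0..1}"
    then show "y \<in> {0..1}"
      using strict_mono_less_eq[OF mono, of 0] strict_mono_less_eq[OF mono, of _ 1] ends by auto
  next
    fix y :: real
    assume "y \<in> {0..1}"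
    then show "y \<in> \<phi> ` {0..1}"
      using IVT'[of \<phi> 0 y 1] continuous_circle_change[OF M] ends by auto
  qed
  then show "\<phi> \<in> time_changes"
    using mono strict_mono_imp_inj_on[OF mono, of "{0..1}"]
    by (auto simp: time_changes_def bij_betw_def strict_mono_on_def strict_mono_def)
  show "\<bar>ln ((\<phi> t - \<phi> s) / (t - s))\<bar> \<le> a" if "s < t"
    using that strict_monoD[OF mono that] circle_changesD(2,3)[OF M, of s t]
    by (simp add: abs_ln_le_iff pos_le_divide_eq pos_divide_le_eq)
qed

section \<open>Loop distances in terms of closeness on the circle\<close>

text \<open>The finite \<open>d\<close> moves to the other side, giving a bound \<open>K - d\<close>
  on the infimum alone. The subtraction is done in the reals, where it is not truncated.\<close>

lemma ennreal_add_INF_less: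
  assumes "0 \<le> d" "ennreal d + (INF i\<in>I. F i) < ennreal K"
  obtains i where "i \<in> I" "ennreal d + F i < ennreal K"
proof -
  define X where "X = (INF i\<in>I. F i)"
  obtain x where x: "0 \<le> x" "X = ennreal x"
    using assms(2) by (cases X) (auto simp: X_def[symmetric])
  then have "d + x < K"
    using assms by (simp add: X_def[symmetric] ennreal_less_iff flip: ennreal_plus)
  then have "X < ennreal (K - d)"
    using x by (simp add: ennreal_less_iff)
  then obtain i where i: "i \<in> I" "F i < ennreal (K - d)"
    unfolding X_def INF_less_iff by blast
  then obtain y where y: "0 \<le> y" "F i = ennreal y"
    by (cases "F i") auto
  then have "d + y < K"
    using i by (simp add: ennreal_less_iff)
  then have "ennreal d + F i < ennreal K"
    using y assms(1) by (simp add: ennreal_less_iff flip: ennreal_plus)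
  then show ?thesis
    using i(1) that by blast
qed

lemma ennreal_add_add_lessE:
  assumes "ennreal d + (A + B) < ennreal K" "0 \<le> d"
  obtains a b where "0 \<le> a" "0 \<le> b" "A = ennreal a" "B = ennreal b" "d + (a + b) < K"
proof -
  obtain a b where "0 \<le> a" "0 \<le> b" "A = ennreal a" "B = ennreal b"
    using assms(1) by (cases A; cases B) auto
  then show ?thesis
    using that assms by (simp add: ennreal_less_iff flip: ennreal_plus)
qed

text \<open>Some time change already stays below \<open>K\<close>, so its two suprema are finite;
  they become \<open>a\<close> and \<open>b\<close>, and periodicity spreads both bounds over the
  line.\<close>

lemma based_loop_dist_less_imp_circle_close:
  assumes l: "l \<in> based_loops" "l' \<in> based_loops" and less: "based_loop_dist l l' < ennreal K"
  obtains a b where "0 \<le> a" "0 \<le> b" "circle_close a b (unroll l) (unroll l')"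
    "\<bar>duration l - duration l'\<bar> + (a + b) < K"
proof -
  obtain \<phi> where \<phi>: "\<phi> \<in> time_changes" and "ennreal \<bar>duration l - duration l'\<bar> +
      ((SUP (s, t)\<in>{(s, t). 0 \<le> s \<and> s < t \<and> t \<le> 1}. ennreal \<bar>ln ((\<phi> t - \<phi> s) / (t - s))\<bar>) +
       (SUP u\<in>{0..1}. ennreal (dist (normalized l (\<phi> u)) (normalized l' u)))) < ennreal K"
    using less unfolding based_loop_dist_def skorokhod_dist_def
    by (rule ennreal_add_INF_less[rotated]) auto
  then obtain a b where ab: "0 \<le> a" "0 \<le> b" "\<bar>duration l - duration l'\<bar> + (a + b) < K"
    and a: "(SUP (s, t)\<in>{(s, t). 0 \<le> s \<and> s < t \<and> t \<le> 1}.
      ennreal \<bar>ln ((\<phi> t - \<phi> s) / (t - s))\<bar>) = ennreal a"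
    and b: "(SUP u\<in>{0..1}. ennreal (dist (normalized l (\<phi> u)) (normalized l' u))) = ennreal b"
    by (elim ennreal_add_add_lessE) auto
  have "\<bar>ln ((\<phi> t - \<phi> s) / (t - s))\<bar> \<le> a" if "0 \<le> s" "s < t" "t \<le> 1" for s t
  proof -
    have "ennreal \<bar>ln ((\<phi> t - \<phi> s) / (t - s))\<bar> \<le> ennreal a"
      unfolding a[symmetric] by (rule SUP_upper2[of "(s, t)"]) (use that in auto)
    then show ?thesis
      using ab(1) by (simp add: ennreal_le_iff)
  qed
  then obtain \<Lambda> where L: "\<Lambda> \<in> circle_changes a" "\<And>x. \<Lambda> x = of_int \<lfloor>x\<rfloor> + \<phi> (frac x)"
    using time_change_lift[OF \<phi> ab(1)] by blast
  have "dist (unroll l (\<Lambda> x)) (unroll l' x) \<le> b" for x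
  proof -
    have x: "frac x \<in> {0..1}"
      using frac_lt_1[of x] by simp
    moreover have "\<phi> (frac x) \<in> {0..1}"
      using \<phi> x by (auto simp: time_changes_def bij_betw_def)
    moreover have "ennreal (dist (normalized l (\<phi> (frac x))) (normalized l' (frac x))) \<le> ennreal b"
      unfolding b[symmetric] by (rule SUP_upper[OF x])
    ultimately have "dist (unroll l (\<phi> (frac x))) (unroll l' (frac x)) \<le> b"
      using ab(2) l by (simp add: unroll_eq_normalized ennreal_le_iff)
    moreover have "unroll l (\<Lambda> x) = unroll l (\<phi> (frac x))"
      by (rule circle_path_cong[OF circle_path_unroll[OF l(1)]]) (simp add: L(2))
    moreover have "unroll l' x = unroll l' (frac x)"
      by (rule circle_path_cong[OF circle_path_unroll[OF l(2)]]) (simp add: frac_def)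
    ultimately show ?thesis
      by simp
  qed
  then have "circle_close a b (unroll l) (unroll l')"
    unfolding circle_close_def by (intro bexI[OF _ L(1)] allI)
  then show ?thesis
    using that ab by blast
qed

lemma based_loop_dist_less_if_circle_change:
  assumes l: "l \<in> based_loops" "l' \<in> based_loops"
    and ab: "0 \<le> a" "0 \<le> b" "\<bar>duration l - duration l'\<bar> + (a + b) < K"
    and L: "\<Lambda> \<in> circle_changes a"
    and start: "\<Lambda> 0 = 0"
    and close: "\<And>x. dist (unroll l (\<Lambda> x)) (unroll l' x) \<le> b"
  shows "based_loop_dist l l' < ennreal K"
proof -
  have \<phi>: "\<Lambda> \<in> time_changes"
    and slope: "\<And>s t. s < t \<Longrightarrow> \<bar>ln ((\<Lambda> t - \<Lambda> s) / (t - s))\<bar> \<le> a"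
    using circle_change_imp_time_change[OF L start] by simp_all
  have "skorokhod_dist (normalized l) (normalized l') \<le> ennreal a + ennreal b"
    unfolding skorokhod_dist_def
  proof (rule INF_lower2[OF \<phi>], rule add_mono)
    show "(SUP (s, t)\<in>{(s, t). 0 \<le> s \<and> s < t \<and> t \<le> 1}.
      ennreal \<bar>ln ((\<Lambda> t - \<Lambda> s) / (t - s))\<bar>) \<le> ennreal a"
      by (rule SUP_least) (auto intro!: ennreal_leI slope)
    show "(SUP u\<in>{0..1}. ennreal (dist (normalized l (\<Lambda> u)) (normalized l' u))) \<le> ennreal b"
    proof (rule SUP_least)
      fix u :: real
      assume u: "u \<in> {0..1}"
      then have "\<Lambda> u \<in> {0..1}"
        using \<phi> by (auto simp: time_changes_def bij_betw_def)
      then show "ennreal (dist (normalized l (\<Lambda> u)) (normalized l' u)) \<le> ennreal b"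
        using close[of u] u l by (simp add: unroll_eq_normalized ennreal_leI)
    qed
  qed
  then have "based_loop_dist l l' \<le>
      ennreal \<bar>duration l - duration l'\<bar> + (ennreal a + ennreal b)"
    unfolding based_loop_dist_def by (rule add_left_mono)
  also have "\<dots> < ennreal K"
    using ab by (simp add: ennreal_less_iff flip: ennreal_plus)
  finally show ?thesis .
qed

text \<open>Countability of the jump times gives base points for both loops that the lift of the time
  change matches and that are jumps of neither loop.\<close>

lemma loop_dist_less_iff:
  fixes l l' :: "'a::metric_space based_loop"
  assumes l: "l \<in> based_loops" and l': "l' \<in> based_loops"
  shows "loop_dist (loop_equiv `` {l}) (loop_equiv `` {l'}) < ennreal K \<longleftrightarrow>
    (\<exists>a b. 0 \<le> a \<and> 0 \<le> b \<and> circle_close a b (unroll l) (unroll l') \<and>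
      \<bar>duration l - duration l'\<bar> + (a + b) < K)"
proof
  assume "loop_dist (loop_equiv `` {l}) (loop_equiv `` {l'}) < ennreal K"
  then obtain m m' where m: "(l, m) \<in> loop_equiv" "(l', m') \<in> loop_equiv"
    and less: "based_loop_dist m m' < ennreal K"
    unfolding loop_dist_def INF_less_iff by blast
  have b: "m \<in> based_loops" "m' \<in> based_loops"
    using m by (auto elim: loop_equivE)
  obtain r r' where "duration m = duration l" "duration m' = duration l'"
    and r: "unroll m = (\<lambda>x. unroll l (x + r))" "unroll m' = (\<lambda>x. unroll l' (x + r'))"
    using m unfolding loop_equiv_iff_unroll[OF l b(1)] loop_equiv_iff_unroll[OF l' b(2)]
    by (auto simp: fun_eq_iff)
  moreover obtain a b where "0 \<le> a" "0 \<le> b" "circle_close a b (unroll m) (unroll m')"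
    "\<bar>duration m - duration m'\<bar> + (a + b) < K"
    by (rule based_loop_dist_less_imp_circle_close[OF b less])
  moreover from this(3) have "circle_close a b (unroll l) (unroll l')"
    unfolding r by (rule circle_close_translate)
  ultimately show "\<exists>a b. 0 \<le> a \<and> 0 \<le> b \<and> circle_close a b (unroll l) (unroll l') \<and>
      \<bar>duration l - duration l'\<bar> + (a + b) < K"
    by (intro exI[of _ a] exI[of _ b]) simp
next
  assume "\<exists>a b. 0 \<le> a \<and> 0 \<le> b \<and> circle_close a b (unroll l) (unroll l') \<and>
      \<bar>duration l - duration l'\<bar> + (a + b) < K"
  then obtain a b \<Lambda> where ab: "0 \<le> a" "0 \<le> b" "\<bar>duration l - duration l'\<bar> + (a + b) < K"
    and L: "\<Lambda> \<in> circle_changes a"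
    and close: "\<And>x. dist (unroll l (\<Lambda> x)) (unroll l' x) \<le> b"
    unfolding circle_close_def by blast
  have u: "circle_path (unroll l)" "circle_path (unroll l')"
    using l l' by (simp_all add: circle_path_unroll)
  then have jumps: "countable {x. \<not> isCont (unroll l) x}" "countable {x. \<not> isCont (unroll l') x}"
    by (simp_all add: circle_path_def countable_discontinuities)
  \<comment> \<open>Injectivity of the lift pulls countability of the jumps back to their
    preimage.\<close>
  have "countable (\<Lambda> ` (\<Lambda> -` {x. \<not> isCont (unroll l) x}))"
    by (rule countable_subset[OF _ jumps(1)]) blast
  then have "countable (\<Lambda> -` {x. \<not> isCont (unroll l) x})"
    by (rule countable_image_inj_on)
       (rule strict_mono_imp_inj_on[OF strict_mono_circle_change[OF L]])
  with jumps(2) have "countable (\<Lambda> -` {x. \<not> isCont (unroll l) x} \<union> {x. \<not> isCont (unroll l') x})"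
    by simp
  then have "\<Lambda> -` {x. \<not> isCont (unroll l) x} \<union> {x. \<not> isCont (unroll l') x} \<noteq> UNIV"
    using uncountable_UNIV_real by metis
  then obtain r where r: "isCont (unroll l) (\<Lambda> r)" "isCont (unroll l') r"
    by blast
  \<comment> \<open>Every continuity point of an unrolled loop can serve as its base point.\<close>
  have re_base: "\<exists>m\<in>based_loops. (k, m) \<in> loop_equiv \<and> duration m = duration k \<and>
      unroll m = (\<lambda>x. unroll k (x + q))"
    if k: "k \<in> based_loops" and cont: "isCont (unroll k) q" for k :: "'a based_loop" and q
  proof -
    define m where "m = roll (duration k) (\<lambda>x. unroll k (x + q))"
    have pos: "duration k > 0"
      using k by (simp add: based_loops_def)
    have path: "circle_path (\<lambda>x. unroll k (x + q))"
      by (rule circle_path_translate[OF circle_path_unroll[OF k]])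
    have "isCont (\<lambda>x. unroll k (x + q)) 0"
      by (rule isCont_o2[of 0 "\<lambda>x. x + q"]) (use cont in auto)
    then have m: "m \<in> based_loops"
      unfolding m_def by (rule roll_in_based_loops[OF pos path])
    moreover have dur: "duration m = duration k"
      by (simp add: m_def roll_def)
    moreover have un: "unroll m = (\<lambda>x. unroll k (x + q))"
      unfolding m_def by (rule unroll_roll[OF pos path])
    moreover have "(k, m) \<in> loop_equiv"
      unfolding loop_equiv_iff_unroll[OF k m] using dur un by auto
    ultimately show ?thesis
      by blast
  qed
  obtain m where m: "m \<in> based_loops" "(l, m) \<in> loop_equiv" "duration m = duration l"
    "unroll m = (\<lambda>x. unroll l (x + \<Lambda> r))"
    using re_base[OF l r(1)] by blast
  obtain m' where m': "m' \<in> based_loops" "(l', m') \<in> loop_equiv" "duration m' = duration l'"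
    "unroll m' = (\<lambda>x. unroll l' (x + r))"
    using re_base[OF l' r(2)] by blast
  have "based_loop_dist m m' < ennreal K"
  proof (rule based_loop_dist_less_if_circle_change[OF m(1) m'(1) ab(1,2)])
    \<comment> \<open>Based at \<open>\<Lambda> r\<close> and \<open>r\<close>, the loops are
      compared by the conjugated lift, which fixes 0 as a time change must.\<close>
    show "(\<lambda>x. \<Lambda> (x + r) - \<Lambda> r) \<in> circle_changes a"
      by (rule circle_changes_translate[OF L])
  qed (use ab m m' close in simp_all)
  then show "loop_dist (loop_equiv `` {l}) (loop_equiv `` {l'}) < ennreal K"
    unfolding loop_dist_def INF_less_iff using m(2) m'(2) by blast
qed

section \<open>Symmetry by inverting time changes\<close>

lemma time_change_inv:
  assumes \<phi>: "\<phi> \<in> time_changes"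
  shows "inv_into {0..1} \<phi> \<in> time_changes"
proof -
  let ?\<psi> = "inv_into {0..1} \<phi>"
  have bij: "bij_betw \<phi> {0..1} {0..1}" and mono: "strict_mono_on {0..1} \<phi>"
    using \<phi> by (simp_all add: time_changes_def)
  have bij': "bij_betw ?\<psi> {0..1} {0..1}"
    using bij by (rule bij_betw_inv_into)
  have "strict_mono_on {0..1} ?\<psi>"
  proof (rule strict_mono_onI, rule ccontr)
    fix s t :: real
    assume st: "s \<in> {0..1}" "t \<in> {0..1}" "s < t" and "\<not> ?\<psi> s < ?\<psi> t"
    moreover have "?\<psi> s \<in> {0..1}" "?\<psi> t \<in> {0..1}"
      using bij_betw_apply[OF bij'] st by blast+
    ultimately have "\<phi> (?\<psi> t) \<le> \<phi> (?\<psi> s)"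
      by (intro strict_mono_on_leD[OF mono]) simp_all
    then show False
      using st by (simp add: bij_betw_inv_into_right[OF bij])
  qed
  then show ?thesis
    using bij' by (simp add: time_changes_def)
qed

text \<open>The slope of the inverse \<open>\<psi>\<close> between \<open>s\<close> and
  \<open>t\<close> is the reciprocal of the slope of \<open>\<phi>\<close> between
  \<open>\<psi> s\<close> and \<open>\<psi> t\<close>, and the absolute logarithm ignores
  reciprocals.\<close>

lemma skorokhod_dist_commute_le: "skorokhod_dist g f \<le> skorokhod_dist f g"
  unfolding skorokhod_dist_def[of f g]
proof (rule INF_greatest)
  fix \<phi>
  assume \<phi>: "\<phi> \<in> time_changes"
  define \<psi> where "\<psi> = inv_into {0..1} \<phi>"
  have \<psi>: "\<psi> \<in> time_changes"
    unfolding \<psi>_def by (rule time_change_inv[OF \<phi>])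
  have in01: "\<psi> u \<in> {0..1}" if "u \<in> {0..1}" for u
    using \<psi> that unfolding time_changes_def by (blast intro: bij_betw_apply)
  have cancel: "\<phi> (\<psi> u) = u" if "u \<in> {0..1}" for u
    unfolding \<psi>_def using \<phi> that
    by (intro bij_betw_inv_into_right[of \<phi> "{0..1}" "{0..1}"]) (simp_all add: time_changes_def)
  show "skorokhod_dist g f \<le>
      (SUP (s, t)\<in>{(s, t). 0 \<le> s \<and> s < t \<and> t \<le> 1}. ennreal \<bar>ln ((\<phi> t - \<phi> s) / (t - s))\<bar>) +
      (SUP u\<in>{0..1}. ennreal (dist (f (\<phi> u)) (g u)))"
    unfolding skorokhod_dist_def
  proof (rule INF_lower2[OF \<psi>], rule add_mono)
    show "(SUP (s, t)\<in>{(s, t). 0 \<le> s \<and> s < t \<and> t \<le> 1}. ennreal \<bar>ln ((\<psi> t - \<psi> s) / (t - s))\<bar>)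
      \<le> (SUP (s, t)\<in>{(s, t). 0 \<le> s \<and> s < t \<and> t \<le> 1}. ennreal \<bar>ln ((\<phi> t - \<phi> s) / (t - s))\<bar>)"
    proof (rule SUP_least, clarify)
      fix s t :: real
      assume st: "0 \<le> s" "s < t" "t \<le> 1"
      have less: "\<psi> s < \<psi> t"
        using \<psi> st by (auto simp: time_changes_def intro: strict_mono_onD)
      have mem: "(\<psi> s, \<psi> t) \<in> {(s, t). 0 \<le> s \<and> s < t \<and> t \<le> 1}"
        using in01[of s] in01[of t] less st by simp
      have "ln ((\<psi> t - \<psi> s) / (t - s)) = - ln ((t - s) / (\<psi> t - \<psi> s))"
        using less st by (simp add: ln_div)
      then have "ennreal \<bar>ln ((\<psi> t - \<psi> s) / (t - s))\<bar> =
          ennreal \<bar>ln ((\<phi> (\<psi> t) - \<phi> (\<psi> s)) / (\<psi> t - \<psi> s))\<bar>"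
        using st by (simp add: cancel)
      then show "ennreal \<bar>ln ((\<psi> t - \<psi> s) / (t - s))\<bar> \<le> (SUP (s, t)\<in>{(s, t). 0 \<le> s \<and> s < t \<and> t \<le> 1}.
          ennreal \<bar>ln ((\<phi> t - \<phi> s) / (t - s))\<bar>)"
        by (intro SUP_upper2[OF mem]) simp
    qed
    show "(SUP u\<in>{0..1}. ennreal (dist (g (\<psi> u)) (f u))) \<le> (SUP u\<in>{0..1}. ennreal (dist (f (\<phi> u)) (g u)))"
    proof (rule SUP_least)
      fix u :: real
      assume u: "u \<in> {0..1}"
      show "ennreal (dist (g (\<psi> u)) (f u)) \<le> (SUP u\<in>{0..1}. ennreal (dist (f (\<phi> u)) (g u)))"
        by (rule SUP_upper2[OF in01[OF u]]) (simp add: cancel[OF u] dist_commute)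
    qed
  qed
qed

text \<open>The metric space locale demands symmetry on the whole type, so time changes of arbitrary
  functions have to be inverted and the unrolled description of the distance does not suffice.\<close>

lemma loop_dist_commute: "loop_dist c c' = loop_dist c' c"
proof -
  have "skorokhod_dist f g = skorokhod_dist g f" for f g :: "real \<Rightarrow> 'a"
    by (intro antisym skorokhod_dist_commute_le)
  then have "based_loop_dist l l' = based_loop_dist l' l" for l l' :: "'a based_loop"
    by (simp add: based_loop_dist_def abs_minus_commute)
  then show ?thesis
    unfolding loop_dist_def by (subst INF_commute) simp
qed

section \<open>Finiteness and the metric axioms on loops\<close>

lemma loop_space_cases:
  assumes "c \<in> loop_space"
  obtains l where "l \<in> based_loops" "c = loop_equiv `` {l}"
  using assms unfolding loop_space_def by (rule quotientE)

lemma loop_dist_finite: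
  fixes c c' :: "'a::metric_space based_loop set"
  assumes "c \<in> loop_space" "c' \<in> loop_space"
  shows "loop_dist c c' < \<infinity>"
proof -
  obtain l where l: "l \<in> based_loops" "c = loop_equiv `` {l}"
    using assms(1) by (rule loop_space_cases)
  obtain l' where l': "l' \<in> based_loops" "c' = loop_equiv `` {l'}"
    using assms(2) by (rule loop_space_cases)
  obtain b where b: "0 \<le> b" "circle_close 0 b (unroll l) (unroll l')"
    using circle_close_exists[OF circle_path_unroll circle_path_unroll] l l' by blast
  \<comment> \<open>The \<open>0\<close> is the slope bound of the identity lift, and the final
    \<open>1\<close> makes the inequality strict.\<close>
  define K where "K = \<bar>duration l - duration l'\<bar> + (0 + b) + 1"
  have "loop_dist c c' < ennreal K"
    unfolding l l' loop_dist_less_iff[OF l(1) l'(1)] using b by (force simp: K_def)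
  also have "\<dots> < \<infinity>"
    by simp
  finally show ?thesis .
qed

text \<open>Finiteness permits the passage to real values. For \<open>K \<le> 0\<close> both sides
  are false.\<close>

lemma enn2real_loop_dist_less_iff:
  fixes l l' :: "'a::metric_space based_loop"
  assumes "l \<in> based_loops" "l' \<in> based_loops"
  shows "enn2real (loop_dist (loop_equiv `` {l}) (loop_equiv `` {l'})) < K \<longleftrightarrow>
    (\<exists>a b. 0 \<le> a \<and> 0 \<le> b \<and> circle_close a b (unroll l) (unroll l') \<and>
      \<bar>duration l - duration l'\<bar> + (a + b) < K)"
proof -
  let ?d = "loop_dist (loop_equiv `` {l}) (loop_equiv `` {l'})"
  have "?d < \<infinity>"
    using assms by (intro loop_dist_finite) (simp_all add: loop_space_def quotientI)
  then have "?d = ennreal (enn2real ?d)"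
    by simp
  then have "enn2real ?d < K \<longleftrightarrow> ?d < ennreal K"
    by (metis enn2real_nonneg ennreal_less_iff)
  then show ?thesis
    using loop_dist_less_iff[OF assms] by simp
qed

text \<open>Arbitrarily small bounds force equal durations and, by
  \<open>circle_close_imp_translate\<close>, a translation between the unrolled paths, which is
  equivalence of the based loops.\<close>

lemma loop_dist_eq_0_iff:
  fixes c c' :: "'a::metric_space based_loop set"
  assumes c: "c \<in> loop_space" "c' \<in> loop_space"
  shows "enn2real (loop_dist c c') = 0 \<longleftrightarrow> c = c'"
proof -
  let ?d = "\<lambda>c c'. enn2real (loop_dist c (c' :: 'a based_loop set))"
  obtain l where l: "l \<in> based_loops" "c = loop_equiv `` {l}"
    using c(1) by (rule loop_space_cases)
  obtain l' where l': "l' \<in> based_loops" "c' = loop_equiv `` {l'}"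
    using c(2) by (rule loop_space_cases)
  show ?thesis
  proof
    assume "?d c c' = 0"
    then have small: "\<exists>a b. 0 \<le> a \<and> 0 \<le> b \<and> circle_close a b (unroll l) (unroll l') \<and>
        \<bar>duration l - duration l'\<bar> + (a + b) < e" if "e > 0" for e
      using enn2real_loop_dist_less_iff[OF l(1) l'(1), of e] l l' that by simp
    have "\<bar>duration l - duration l'\<bar> \<le> 0"
    proof (rule dense_ge)
      fix e :: real
      assume "0 < e"
      then show "\<bar>duration l - duration l'\<bar> \<le> e"
        using small[of e] by force
    qed
    then have "duration l = duration l'"
      by simp
    moreover have "\<exists>r. \<forall>x. unroll l' x = unroll l (x + r)"
    proof (rule circle_close_imp_translate)
      show "circle_path (unroll l)" "circle_path (unroll l')"
        using l l' by (simp_all add: circle_path_unroll)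
      show "\<exists>a b. 0 \<le> a \<and> 0 \<le> b \<and> a + b < e \<and> circle_close a b (unroll l) (unroll l')"
        if "e > 0" for e
        using small[OF that] by force
    qed
    ultimately have "(l, l') \<in> loop_equiv"
      using loop_equiv_iff_unroll[OF l(1) l'(1)] by simp
    then show "c = c'"
      using equiv_class_eq[OF equiv_loop_equiv] l l' by blast
  next
    assume "c = c'"
    have "circle_close 0 0 (unroll l) (unroll l)"
      unfolding circle_close_def by (intro bexI[OF _ id_in_circle_changes]) simp
    then have "?d c c < K" if "0 < K" for K
      unfolding l enn2real_loop_dist_less_iff[OF l(1) l(1)]
      using that by (intro exI[of _ 0]) simp
    then have "?d c c \<le> 0"
      by - (rule dense_ge, simp add: less_imp_le)
    then show "?d c c' = 0"
      unfolding \<open>c = c'\<close>[symmetric] by (rule antisym) simp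
  qed
qed

text \<open>Infima need not be attained, so each summand gets a slack of \<open>e / 2\<close>. One
  fixed \<open>l2\<close> represents the middle loop in both estimates, so the lifts compose
  directly.\<close>

lemma loop_dist_triangle:
  fixes c1 c2 c3 :: "'a::metric_space based_loop set"
  assumes c: "c1 \<in> loop_space" "c2 \<in> loop_space" "c3 \<in> loop_space"
  shows "enn2real (loop_dist c1 c3) \<le> enn2real (loop_dist c1 c2) + enn2real (loop_dist c2 c3)"
proof -
  let ?d = "\<lambda>c c'. enn2real (loop_dist c (c' :: 'a based_loop set))"
  obtain l1 where l1: "l1 \<in> based_loops" "c1 = loop_equiv `` {l1}"
    using c(1) by (rule loop_space_cases)
  obtain l2 where l2: "l2 \<in> based_loops" "c2 = loop_equiv `` {l2}"
    using c(2) by (rule loop_space_cases)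
  obtain l3 where l3: "l3 \<in> based_loops" "c3 = loop_equiv `` {l3}"
    using c(3) by (rule loop_space_cases)
  show ?thesis
  proof (rule field_le_epsilon)
    fix e :: real
    assume "0 < e"
    then have "?d c1 c2 < ?d c1 c2 + e / 2" "?d c2 c3 < ?d c2 c3 + e / 2"
      by simp_all
    then obtain a b a' b' where ab: "0 \<le> a" "0 \<le> b" "0 \<le> a'" "0 \<le> b'"
      and close: "circle_close a b (unroll l1) (unroll l2)"
        "circle_close a' b' (unroll l2) (unroll l3)"
      and sums: "\<bar>duration l1 - duration l2\<bar> + (a + b) < ?d c1 c2 + e / 2"
        "\<bar>duration l2 - duration l3\<bar> + (a' + b') < ?d c2 c3 + e / 2"
      using enn2real_loop_dist_less_iff[OF l1(1) l2(1), of "?d c1 c2 + e / 2"]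
        enn2real_loop_dist_less_iff[OF l2(1) l3(1), of "?d c2 c3 + e / 2"]
        l1(2) l2(2) l3(2) by blast
    have "\<bar>duration l1 - duration l3\<bar> + ((a + a') + (b + b')) < ?d c1 c2 + ?d c2 c3 + e"
      using sums by linarith
    moreover have "0 \<le> a + a'" "0 \<le> b + b'"
      using ab by simp_all
    ultimately have "?d c1 c3 < ?d c1 c2 + ?d c2 c3 + e"
      using circle_close_trans[OF close]
      unfolding l1(2) l3(2) enn2real_loop_dist_less_iff[OF l1(1) l3(1)] by blast
    then show "?d c1 c3 \<le> ?d c1 c2 + ?d c2 c3 + e"
      by simp
  qed
qed

text \<open>As \<open>enn2real\<close> sends infinity to 0, finiteness is stated separately: it
  ensures that the real-valued metric is the loop distance itself.\<close>

theorem proposition1: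
  shows "(\<forall>c\<in>loop_space. \<forall>c'\<in>loop_space.
      loop_dist c (c' :: 'a::polish_space based_loop set) < \<infinity>) \<and>
    Metric_space (loop_space :: 'a based_loop set set) (\<lambda>c c'. enn2real (loop_dist c c'))"
  by (intro conjI ballI loop_dist_finite Metric_space.intro enn2real_nonneg loop_dist_eq_0_iff
    loop_dist_triangle arg_cong[OF loop_dist_commute])

end
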